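(* Let $n\ge 1$. For $\pi\in\mathfrak D^2_{2n}(3142)$, let $\psi(\pi)$ be the collection of sets obtained as follows: for each cycle of length at least $2$ in the cycle decomposition of $\pi$, take the set of its even entries and divide all of them by $2$. Then $\psi$ is a bijection from $\mathfrak D^2_{2n}(3142)$ to the set $NC(n)$ of noncrossing partitions of $\{1,\dots,n\}$, and for every $k\ge 0$ it sends permutations with exactly $k$ fixed points to noncrossing partitions with exactly $n-k$ parts.
   Context: A permutation $\sigma\in\mathfrak S_N$ contains a pattern $\tau\in\mathfrak S_k$ if there are positions $i_1<\dots<i_k$ such that $(\sigma(i_1),\dots,\sigma(i_k))$ is order-isomorphic to $\tau$; otherwise $\sigma$ avoids $\tau$. A Dumont permutation of the second kind is a permutation $\pi\in\mathfrak S_{2n}$ such that $\pi(2i)<2i$ and $\pi(2i-1)\ge 2i-1$ for every $i=1,\dots,n$. $\mathfrak D^2_{2n}$ is the set of these, and $\mathfrak D^2_{2n}(3142)$ is the subset of those avoiding $3142$. A set partition of $\{1,\dots,n\}$ is noncrossing if there are no $a<b<c<d$ with $a,c$ in one block and $b,d$ in a different block. Example: $\pi=(12,8,2,1)(6,4,3)(10,9)(16,14,13)(15)(11)(7)(5)$ (in cycle notation) is sent to $\{1,4,6\},\{2,3\},\{5\},\{7,8\}$. *)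

theory Defs
  imports "HOL-Combinatorics.Combinatorics" "HOL-Library.Disjoint_Sets"
begin

text \<open>A permutation in the symmetric group on N letters is a function on the natural numbers with
  \<^term>\<open>\<sigma> permutes {1..N}\<close>, so it is the identity outside \<^term>\<open>{1..N}\<close>.\<close>

definition contains_pattern :: "nat \<Rightarrow> (nat \<Rightarrow> nat) \<Rightarrow> nat \<Rightarrow> (nat \<Rightarrow> nat) \<Rightarrow> bool" where
  "contains_pattern N \<sigma> k \<tau> \<longleftrightarrow>
     (\<exists>i. strict_mono_on {1..k} i \<and> i ` {1..k} \<subseteq> {1..N} \<and>
          (\<forall>a\<in>{1..k}. \<forall>b\<in>{1..k}. \<sigma> (i a) < \<sigma> (i b) \<longleftrightarrow> \<tau> a < \<tau> b))"

definition avoids_pattern :: "nat \<Rightarrow> (nat \<Rightarrow> nat) \<Rightarrow> nat \<Rightarrow> (nat \<Rightarrow> nat) \<Rightarrow> bool" where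
  "avoids_pattern N \<sigma> k \<tau> \<longleftrightarrow> \<not> contains_pattern N \<sigma> k \<tau>"

definition pattern_3142 :: "nat \<Rightarrow> nat" where
  "pattern_3142 = id(1 := 3, 2 := 1, 3 := 4, 4 := 2)"

lemma pattern_3142_permutes: "pattern_3142 permutes {1..4}"
proof (rule bij_imp_permutes)
  have S: "{1..4::nat} = {1, 2, 3, 4}" by auto
  show "bij_betw pattern_3142 {1..4} {1..4}"
    unfolding S bij_betw_def by (auto simp: pattern_3142_def inj_on_def)
qed (auto simp: pattern_3142_def)

definition dumont2 :: "nat \<Rightarrow> (nat \<Rightarrow> nat) set" where
  "dumont2 n = {\<pi>. \<pi> permutes {1..2 * n} \<and>
     (\<forall>i\<in>{1..n}. \<pi> (2 * i) < 2 * i \<and> \<pi> (2 * i - 1) \<ge> 2 * i - 1)}"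

definition dumont2_3142 :: "nat \<Rightarrow> (nat \<Rightarrow> nat) set" where
  "dumont2_3142 n = {\<pi> \<in> dumont2 n. avoids_pattern (2 * n) \<pi> 4 pattern_3142}"

definition noncrossing :: "nat set set \<Rightarrow> bool" where
  "noncrossing P \<longleftrightarrow>
     \<not> (\<exists>A\<in>P. \<exists>B\<in>P. A \<noteq> B \<and>
          (\<exists>a b c d. a < b \<and> b < c \<and> c < d \<and> a \<in> A \<and> c \<in> A \<and> b \<in> B \<and> d \<in> B))"

definition NC :: "nat \<Rightarrow> nat set set set" where
  "NC n = {P. partition_on {1..n} P \<and> noncrossing P}"

text \<open>The entries of the cycles of a permutation are its orbits; the length of a cycle is the
  cardinality of its orbit.\<close>

definition cycle_sets :: "nat \<Rightarrow> (nat \<Rightarrow> nat) \<Rightarrow> nat set set" where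
  "cycle_sets N \<sigma> = orbit \<sigma> ` {1..N}"

definition psi :: "nat \<Rightarrow> (nat \<Rightarrow> nat) \<Rightarrow> nat set set" where
  "psi n \<pi> = {(\<lambda>x. x div 2) ` {x \<in> C. even x} | C. C \<in> cycle_sets (2 * n) \<pi> \<and> card C \<ge> 2}"

definition fixed_points :: "nat \<Rightarrow> (nat \<Rightarrow> nat) \<Rightarrow> nat set" where
  "fixed_points N \<sigma> = {x \<in> {1..N}. \<sigma> x = x}"

end

theory Submission
  imports Defs
begin

text \<open>If \<open>\<pi>\<close> is a 3142-avoiding Dumont permutation of the second kind and \<open>p\<close> is an odd
  non-fixed point, then \<open>\<pi> p\<close> is even, \<open>\<pi> (p + 1) = p\<close>, and \<open>\<pi>\<close> preserves the interval
  \<open>{p..\<pi> p}\<close>. These intervals are nested or disjoint, so a nontrivial cycle contains exactly one odd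
  entry \<open>p\<close>, lies in \<open>{p..\<pi> p}\<close>, and has the form \<open>2 a\<^sub>r, \<dots>, 2 a\<^sub>2, 2 a\<^sub>1, 2 a\<^sub>1 - 1\<close> with
  \<open>a\<^sub>1 < a\<^sub>2 < \<dots> < a\<^sub>r\<close>. Hence the blocks \<open>{a\<^sub>1, \<dots>, a\<^sub>r}\<close> do not cross and determine \<open>\<pi>\<close>,
  and the fixed points are the \<open>2 i - 1\<close> for which \<open>i\<close> is not the minimum of its block. Conversely,
  for any noncrossing partition these cycles define a Dumont permutation that avoids 3142.\<close>

text \<open>The chain of inequalities lists the four positions by increasing pattern value; all
  other comparisons follow by transitivity.\<close>

lemma avoids_3142_iff:
  "avoids_pattern N \<sigma> 4 pattern_3142 \<longleftrightarrow>
     (\<forall>a b c d. 1 \<le> a \<longrightarrow> a < b \<longrightarrow> b < c \<longrightarrow> c < d \<longrightarrow> d \<le> N \<longrightarrow>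
        \<not> (\<sigma> b < \<sigma> d \<and> \<sigma> d < \<sigma> a \<and> \<sigma> a < \<sigma> c))"
proof -
  have S: "{1..4::nat} = {1, 2, 3, 4}" by auto
  have "contains_pattern N \<sigma> 4 pattern_3142 \<longleftrightarrow>
     (\<exists>a b c d. 1 \<le> a \<and> a < b \<and> b < c \<and> c < d \<and> d \<le> N \<and>
        \<sigma> b < \<sigma> d \<and> \<sigma> d < \<sigma> a \<and> \<sigma> a < \<sigma> c)" (is "?L \<longleftrightarrow> ?R")
  proof
    assume ?L
    then obtain i :: "nat \<Rightarrow> nat" where i: "strict_mono_on {1, 2, 3, 4} i" "i ` {1, 2, 3, 4} \<subseteq> {1..N}"
      "\<forall>a\<in>{1, 2, 3, 4}. \<forall>b\<in>{1, 2, 3, 4}. \<sigma> (i a) < \<sigma> (i b) \<longleftrightarrow> pattern_3142 a < pattern_3142 b"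
      unfolding contains_pattern_def S by blast
    have "i 1 < i 2 \<and> i 2 < i 3 \<and> i 3 < i 4"
      using i(1) unfolding strict_mono_on_def by simp
    moreover have "1 \<le> i 1" "i 4 \<le> N" using i(2) by auto
    moreover have "\<sigma> (i 2) < \<sigma> (i 4) \<and> \<sigma> (i 4) < \<sigma> (i 1) \<and> \<sigma> (i 1) < \<sigma> (i 3)"
      using i(3) by (simp add: pattern_3142_def)
    ultimately show ?R by blast
  next
    assume ?R
    then obtain a b c d where *: "1 \<le> a" "a < b" "b < c" "c < d" "d \<le> N"
      "\<sigma> b < \<sigma> d" "\<sigma> d < \<sigma> a" "\<sigma> a < \<sigma> c" by blast
    define i where "i = id(1 := a, 2 := b, 3 := c, 4 := d)"
    have "strict_mono_on {1, 2, 3, 4} i" "i ` {1, 2, 3, 4} \<subseteq> {1..N}"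
      using * unfolding strict_mono_on_def i_def by auto
    moreover have "\<forall>a\<in>{1, 2, 3, 4}. \<forall>b\<in>{1, 2, 3, 4}.
        \<sigma> (i a) < \<sigma> (i b) \<longleftrightarrow> pattern_3142 a < pattern_3142 b"
      using * by (auto simp: pattern_3142_def i_def)
    ultimately show ?L unfolding contains_pattern_def S by blast
  qed
  thus ?thesis unfolding avoids_pattern_def by blast
qed

section \<open>Cycles of 3142-avoiding Dumont permutations\<close>

locale dumont_3142 =
  fixes n :: nat and \<pi> :: "nat \<Rightarrow> nat"
  assumes pi: "\<pi> \<in> dumont2_3142 n"
begin

lemma perm: "\<pi> permutes {1..2 * n}"
  using pi by (simp add: dumont2_3142_def dumont2_def)

lemma inj: "\<pi> x = \<pi> y \<Longrightarrow> x = y"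
  using permutes_inj[OF perm] by (simp add: inj_eq)

lemma in_range: "\<pi> x \<in> {1..2 * n} \<longleftrightarrow> x \<in> {1..2 * n}"
  using permutes_in_image[OF perm] .

lemma outside: "x \<notin> {1..2 * n} \<Longrightarrow> \<pi> x = x"
  using permutes_not_in[OF perm] .

lemma even_less: "even x \<Longrightarrow> x \<in> {1..2 * n} \<Longrightarrow> \<pi> x < x"
proof (elim evenE)
  fix i assume "x = 2 * i" "x \<in> {1..2 * n}"
  moreover have "\<forall>i\<in>{1..n}. \<pi> (2 * i) < 2 * i"
    using pi by (simp add: dumont2_3142_def dumont2_def)
  ultimately show "\<pi> x < x" by auto
qed

lemma odd_ge: "odd x \<Longrightarrow> x \<le> \<pi> x"
proof (cases "x \<in> {1..2 * n}")
  case True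
  assume "odd x"
  then obtain j where "x = 2 * j + 1" by (elim oddE)
  then have j: "x = 2 * Suc j - 1" "Suc j \<in> {1..n}" using True by auto
  moreover have "\<forall>i\<in>{1..n}. \<pi> (2 * i - 1) \<ge> 2 * i - 1"
    using pi by (simp add: dumont2_3142_def dumont2_def)
  ultimately show ?thesis by blast
qed (simp add: outside)

lemma ge_imp_odd: "x \<le> \<pi> x \<Longrightarrow> x \<in> {1..2 * n} \<Longrightarrow> odd x"
  using even_less by (meson leD)

lemma avoid:
  "1 \<le> a \<Longrightarrow> a < b \<Longrightarrow> b < c \<Longrightarrow> c < d \<Longrightarrow> d \<le> 2 * n \<Longrightarrow>
     \<pi> b < \<pi> d \<Longrightarrow> \<pi> d < \<pi> a \<Longrightarrow> \<pi> a < \<pi> c \<Longrightarrow> False"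
  using pi by (auto simp: dumont2_3142_def avoids_3142_iff)

text \<open>Strong induction on \<open>p\<close>: the intervals of smaller odd excedances are
  already known to be invariant, which controls the values at positions left of
  \<open>p\<close>.\<close>

lemma excedance:
  assumes "odd p" "\<pi> p \<noteq> p"
  shows "even (\<pi> p) \<and> \<pi> (p + 1) = p \<and> \<pi> ` {p..\<pi> p} = {p..\<pi> p}"
  using assms
proof (induction p rule: less_induct)
  case (less p)
  have p: "p \<in> {1..2 * n}" using less.prems outside by blast
  define w where "w = \<pi> p"
  define q where "q = \<pi> (p + 1)"
  have pw: "p < w" using odd_ge[OF less.prems(1)] less.prems(2) by (simp add: w_def)
  have w: "w \<le> 2 * n" using p in_range[of p] by (simp add: w_def)
  have p1: "p + 1 \<in> {1..2 * n}" using pw w by auto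
  have q: "q \<le> p" using even_less[OF _ p1] less.prems(1) by (simp add: q_def)
  \<comment> \<open>The invariant interval of \<open>x\<close> contains \<open>p\<close>, hence also
    \<open>w\<close>, and injectivity makes the inequality strict. So no position left of
    \<open>p\<close> carries a value in \<open>{p..w}\<close>.\<close>
  have before: "w < \<pi> x" if "x < p" "p \<le> \<pi> x" for x
  proof -
    have x: "x \<in> {1..2 * n}" using outside[of x] that by (cases "x \<in> {1..2 * n}") auto
    have "odd x" "\<pi> x \<noteq> x" using ge_imp_odd[OF _ x] that by auto
    then have "\<pi> ` {x..\<pi> x} = {x..\<pi> x}" using less.IH that by blast
    moreover have "p \<in> {x..\<pi> x}" using that by auto
    ultimately have "w \<in> {x..\<pi> x}" unfolding w_def by blast
    moreover have "w \<noteq> \<pi> x" using inj[of p x] that unfolding w_def by auto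
    ultimately show ?thesis by auto
  qed
  \<comment> \<open>Any value strictly between \<open>q\<close> and \<open>w\<close> placed after position \<open>p + 1\<close> must precede every larger
    one, in particular the one at the odd position \<open>s\<close>. So the values \<open>p + 1, \<dots>, w - 1\<close> all sit at
    positions \<open>p + 2, \<dots>, s - 1\<close>; counting forces \<open>w\<close> even and leaves no place for \<open>p\<close> but \<open>p + 1\<close>.\<close>
  define s where "s = (if odd w then w else w + 1)"
  have s: "odd s" "p + 1 < s" using pw less.prems(1) by (auto simp: s_def elim!: oddE)
  have late: "x < s" if "q < \<pi> x" "\<pi> x < w" for x
  proof (rule ccontr)
    assume "\<not> x < s"
    then have xs: "s \<le> x" by simp
    have "x \<in> {1..2 * n}" using outside[of x] that w xs by (auto simp: s_def split: if_splits)
    then have x: "x \<le> 2 * n" by simp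
    have "s \<le> \<pi> s" using odd_ge s by blast
    moreover have "w \<noteq> \<pi> s" using inj[of p s] s unfolding w_def by auto
    ultimately have ws: "w < \<pi> s" by (auto simp: s_def split: if_splits)
    then have "s \<noteq> x" using that by auto
    \<comment> \<open>Positions \<open>p\<close>, \<open>p + 1\<close>, \<open>s\<close>,
      \<open>x\<close> carry \<open>w\<close>, \<open>q\<close>, a value above \<open>w\<close>, and
      a value strictly between \<open>q\<close> and \<open>w\<close>: an occurrence of 3142.\<close>
    then show False
      using avoid[of p "p + 1" s x] p s xs x that ws by (simp add: w_def q_def)
  qed
  have preim: "\<exists>x. \<pi> x = v" for v using permutes_surj[OF perm] by (metis surjD)
  have sub: "{p + 1..<w} \<subseteq> \<pi> ` {p + 2..<s}"
  proof
    fix v assume v: "v \<in> {p + 1..<w}"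
    obtain x where x: "\<pi> x = v" using preim by blast
    have "\<not> x < p" using before[of x] v x by auto
    moreover have "x \<noteq> p" "x \<noteq> p + 1" using v x q by (auto simp: w_def q_def)
    moreover have "x < s" using late v x q by auto
    ultimately show "v \<in> \<pi> ` {p + 2..<s}" using x by auto
  qed
  have card: "card (\<pi> ` {p + 2..<s}) = s - (p + 2)"
    by (subst card_image) (auto simp: inj_on_def dest: inj)
  \<comment> \<open>For odd \<open>w\<close>, where \<open>s = w\<close>, there would be one
    position too few for these values.\<close>
  have "w - (p + 1) \<le> s - (p + 2)" using card_mono[OF _ sub] card by simp
  then have ev: "even w" and sw: "s = w + 1" using pw s by (auto simp: s_def split: if_splits)
  have img: "\<pi> ` {p + 2..<s} = {p + 1..<w}"
    using card_subset_eq[OF _ sub] card sw by simp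
  have qp: "q = p"
  proof (rule ccontr)
    assume "q \<noteq> p"
    with q have qp: "q < p" by simp
    obtain x where x: "\<pi> x = p" using preim by blast
    have "\<not> x < p" using before[of x] pw x by auto
    moreover have "x \<noteq> p" "x \<noteq> p + 1" using x qp pw by (auto simp: w_def q_def)
    moreover have "x < s" using late x qp pw by auto
    ultimately have "p \<in> \<pi> ` {p + 2..<s}" using x by force
    then show False using img by auto
  qed
  have "{p..w} = insert p (insert (p + 1) {p + 2..<s})" using pw sw by auto
  then have "\<pi> ` {p..w} = insert w (insert p {p + 1..<w})"
    using img qp by (simp add: w_def q_def)
  also have "\<dots> = {p..w}" using pw by auto
  finally show ?case using ev qp by (simp add: w_def q_def)
qed

lemma excedance_gt: "odd p \<Longrightarrow> \<pi> p \<noteq> p \<Longrightarrow> p < \<pi> p"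
  using odd_ge by (simp add: order_le_neq_trans)

section \<open>Orbits of nontrivial cycles\<close>

lemma permutation: "permutation \<pi>"
  using perm permutation_permutes by blast

lemma self_in: "x \<in> orbit \<pi> x"
  by (rule permutation_self_in_orbit[OF permutation])

lemma orbit_eq: "y \<in> orbit \<pi> x \<Longrightarrow> orbit \<pi> y = orbit \<pi> x"
  by (meson orbit_swap orbit_trans self_in subsetI subset_antisym)

text \<open>Preservation of \<open>W\<close> is asked for on the orbit alone, because the set in
  \<open>orbit_step_least\<close> is only shown to be preserved there.\<close>

lemma orbit_closed:
  assumes "\<And>y. y \<in> orbit \<pi> x \<Longrightarrow> y \<in> W \<Longrightarrow> \<pi> y \<in> W" "x \<in> W"
  shows "orbit \<pi> x \<subseteq> W"
proof
  fix y assume "y \<in> orbit \<pi> x"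
  then show "y \<in> W"
    by induction (auto intro: assms self_in)
qed

lemma orbit_in_interval:
  assumes "odd p" "\<pi> p \<noteq> p" "x \<in> {p..\<pi> p}"
  shows "orbit \<pi> x \<subseteq> {p..\<pi> p}"
  using excedance[OF assms(1,2)] assms(3) by (intro orbit_closed) blast+

text \<open>Both odd entries are excedances, and the invariant interval of each contains the whole
  common orbit, so each is at most the other.\<close>

lemma unique_odd:
  assumes "odd p" "\<pi> p \<noteq> p" "odd p'" "p' \<in> orbit \<pi> p"
  shows "p' = p"
proof -
  have "\<pi> p' \<noteq> p'"
    using assms orbit_eq[OF assms(4)] orbit_eq_singleton_iff[of \<pi>] self_in[of p]
    by (metis singletonD)
  have "p \<le> p'" using orbit_in_interval[OF assms(1,2), of p] assms(4) excedance_gt[OF assms(1,2)] by auto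
  moreover have "p' \<le> p"
    using orbit_in_interval[OF assms(3) \<open>\<pi> p' \<noteq> p'\<close>, of p'] excedance_gt[OF assms(3) \<open>\<pi> p' \<noteq> p'\<close>]
      orbit_eq[OF assms(4)] self_in[of p] by auto
  ultimately show ?thesis by simp
qed

text \<open>Descent: \<open>\<pi>\<close> strictly lowers even entries, so iteration reaches an odd
  one. By injectivity that entry is not fixed, since it is the image of a different point.\<close>

lemma odd_in_orbit:
  assumes "x \<in> {1..2 * n}" "even x"
  obtains p where "odd p" "\<pi> p \<noteq> p" "p \<in> orbit \<pi> x"
proof -
  have "\<exists>p. odd p \<and> \<pi> p \<noteq> p \<and> p \<in> orbit \<pi> x"
    using assms
  proof (induction x rule: less_induct)
    case (less x)
    have lt: "\<pi> x < x" using even_less less.prems by blast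
    show ?case
    proof (cases "even (\<pi> x)")
      case True
      then have "\<exists>p. odd p \<and> \<pi> p \<noteq> p \<and> p \<in> orbit \<pi> (\<pi> x)"
        using less lt in_range by blast
      then show ?thesis by (meson orbit_subset)
    next
      case False
      have "\<pi> (\<pi> x) \<noteq> \<pi> x" using inj lt by (metis less_irrefl)
      then show ?thesis using False orbit.base[of \<pi> x] by blast
    qed
  qed
  then show ?thesis using that by blast
qed

text \<open>The cycle leaves no entry strictly between \<open>\<pi> z\<close> and \<open>z\<close>.
  Induction runs downwards in \<open>z\<close>: an even entry above \<open>z\<close> cannot jump
  over \<open>z\<close> by the hypothesis for that entry, an even entry at most
  \<open>\<pi> z\<close> only falls further, and the odd entry \<open>p\<close> goes to the maximum
  \<open>\<pi> p\<close>.\<close>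

lemma orbit_step_least:
  assumes "odd p" "\<pi> p \<noteq> p" "z \<in> orbit \<pi> p" "even z"
  shows "\<forall>y \<in> orbit \<pi> p. z \<le> y \<or> y \<le> \<pi> z"
  using assms(3,4)
proof (induction "2 * n - z" arbitrary: z rule: less_induct)
  case less
  have p: "p \<in> {1..2 * n}" using assms outside by blast
  have range: "y \<in> {1..2 * n}" if "y \<in> orbit \<pi> p" for y
    using orbit_in_interval[OF assms(1,2), of p] in_range[of p] p that excedance_gt[OF assms(1,2)]
    by fastforce
  have le_w: "y \<le> \<pi> p" if "y \<in> orbit \<pi> p" for y
    using orbit_in_interval[OF assms(1,2), of p] that excedance_gt[OF assms(1,2)] by fastforce
  have "orbit \<pi> z \<subseteq> {y. z \<le> y \<or> y \<le> \<pi> z}"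
  proof (rule orbit_closed)
    fix y assume "y \<in> orbit \<pi> z" and W: "y \<in> {y. z \<le> y \<or> y \<le> \<pi> z}"
    then have y: "y \<in> orbit \<pi> p" using orbit_eq less.prems by blast
    show "\<pi> y \<in> {y. z \<le> y \<or> y \<le> \<pi> z}"
    proof (cases "odd y")
      case True
      then have "y = p" using unique_odd assms y by blast
      then show ?thesis using le_w less.prems by simp
    next
      case False
      consider "z < y" | "z = y" | "y \<le> \<pi> z" using W by fastforce
      then show ?thesis
      proof cases
        case 1
        then have "2 * n - y < 2 * n - z" using range[OF y] by auto
        then have "\<forall>z'\<in>orbit \<pi> p. y \<le> z' \<or> z' \<le> \<pi> y" using less.hyps y False by blast
        then show ?thesis using 1 less.prems by fastforce
      next
        case 3
        then show ?thesis using even_less[OF _ range[OF y]] False by force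
      qed simp
    qed
  qed simp
  then show ?case using orbit_eq less.prems by blast
qed


section \<open>The image under \<open>psi\<close> as a noncrossing partition\<close>

lemma psi_mem_iff:
  "B \<in> psi n \<pi> \<longleftrightarrow> (\<exists>p. odd p \<and> \<pi> p \<noteq> p \<and> B = {i. 2 * i \<in> orbit \<pi> p})"
proof -
  have half: "(\<lambda>x. x div 2) ` {x \<in> C. even x} = {i. 2 * i \<in> C}" for C :: "nat set"
  proof (intro set_eqI iffI)
    show "i \<in> (\<lambda>x. x div 2) ` {x \<in> C. even x}" if "i \<in> {i. 2 * i \<in> C}" for i
      by (rule image_eqI[of _ _ "2 * i"]) (use that in simp_all)
  qed auto
  have nontriv: "card (orbit \<pi> x) \<ge> 2 \<longleftrightarrow> \<pi> x \<noteq> x" for x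
  proof
    show "\<pi> x \<noteq> x" if "card (orbit \<pi> x) \<ge> 2"
      using that orbit_eq_singleton_iff[of \<pi> x] by auto
  next
    assume "\<pi> x \<noteq> x"
    moreover have "finite (orbit \<pi> x)" by (rule finite_orbit[OF self_in])
    then have "card {x, \<pi> x} \<le> card (orbit \<pi> x)"
      by (rule card_mono) (simp add: self_in orbit.base)
    ultimately show "card (orbit \<pi> x) \<ge> 2" by (simp add: card_insert_if)
  qed
  show ?thesis
  proof
    assume "B \<in> psi n \<pi>"
    then obtain x where x: "x \<in> {1..2 * n}" "\<pi> x \<noteq> x" "B = {i. 2 * i \<in> orbit \<pi> x}"
      unfolding psi_def cycle_sets_def half by (auto simp: nontriv)
    \<comment> \<open>Each block is indexed by the odd entry of its cycle; passing from
      \<open>x\<close> to that entry leaves the orbit unchanged.\<close>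
    show "\<exists>p. odd p \<and> \<pi> p \<noteq> p \<and> B = {i. 2 * i \<in> orbit \<pi> p}"
    proof (cases "even x")
      case True
      then obtain p where p: "odd p" "\<pi> p \<noteq> p" "p \<in> orbit \<pi> x" using odd_in_orbit x by blast
      then show ?thesis using x(3) orbit_eq[OF p(3)] by metis
    qed (use x in blast)
  next
    assume "\<exists>p. odd p \<and> \<pi> p \<noteq> p \<and> B = {i. 2 * i \<in> orbit \<pi> p}"
    then obtain p where p: "\<pi> p \<noteq> p" "B = {i. 2 * i \<in> orbit \<pi> p}" by blast
    then have "p \<in> {1..2 * n}" using outside by blast
    then show "B \<in> psi n \<pi>" unfolding psi_def cycle_sets_def half using p nontriv by blast
  qed
qed

lemma orbit_bounds:
  assumes "odd p" "\<pi> p \<noteq> p" "x \<in> orbit \<pi> p"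
  shows "p \<le> x" "x \<le> \<pi> p"
  using orbit_in_interval[OF assms(1,2), of p] excedance_gt[OF assms(1,2)] assms(3) by auto

lemma Suc_in_orbit:
  assumes "odd p" "\<pi> p \<noteq> p"
  shows "p + 1 \<in> orbit \<pi> p"
proof -
  have "p \<in> orbit \<pi> (p + 1)" using orbit.base[of \<pi> "p + 1"] excedance[OF assms] by simp
  then show ?thesis using orbit_eq self_in by blast
qed

text \<open>Noncrossing comes from the invariant intervals: \<open>a < b < c\<close> puts
  \<open>2 * b\<close> into the interval of \<open>p\<close>, so the orbit of \<open>q\<close> stays
  there and \<open>p \<le> q\<close>; \<open>b < c < d\<close> gives \<open>q \<le> p\<close> in the
  same way.\<close>

lemma psi_NC: "psi n \<pi> \<in> NC n"
  unfolding NC_def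
proof (intro CollectI conjI)
  show "partition_on {1..n} (psi n \<pi>)"
  proof (rule partition_onI)
    have "B \<noteq> {}" if B: "B \<in> psi n \<pi>" for B
    proof -
      obtain p where p: "odd p" "\<pi> p \<noteq> p" "B = {i. 2 * i \<in> orbit \<pi> p}"
        using B unfolding psi_mem_iff by blast
      obtain j where "\<pi> p = 2 * j" using excedance[OF p(1,2)] by (auto elim: evenE)
      then have "j \<in> B" using orbit.base[of \<pi> p] p(3) by simp
      then show ?thesis by blast
    qed
    then show "{} \<notin> psi n \<pi>" by blast
  next
    show "\<Union> (psi n \<pi>) = {1..n}"
    proof (intro set_eqI iffI)
      fix i assume "i \<in> \<Union> (psi n \<pi>)"
      then obtain B where B: "B \<in> psi n \<pi>" "i \<in> B" by blast
      then obtain p where p: "odd p" "\<pi> p \<noteq> p" "2 * i \<in> orbit \<pi> p"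
        unfolding psi_mem_iff by blast
      moreover have "p \<in> {1..2 * n}" using outside p by blast
      ultimately show "i \<in> {1..n}"
        using orbit_bounds[OF p] in_range[of p] by auto
    next
      fix i assume "i \<in> {1..n}"
      then have "2 * i \<in> {1..2 * n}" by auto
      then obtain p where p: "odd p" "\<pi> p \<noteq> p" "p \<in> orbit \<pi> (2 * i)"
        by (rule odd_in_orbit) auto
      then have "2 * i \<in> orbit \<pi> p" using orbit_eq[OF p(3)] self_in by blast
      moreover have "{i. 2 * i \<in> orbit \<pi> p} \<in> psi n \<pi>" unfolding psi_mem_iff using p by blast
      ultimately show "i \<in> \<Union> (psi n \<pi>)" by blast
    qed
  next
    fix B B' assume "B \<in> psi n \<pi>" "B' \<in> psi n \<pi>" and ne: "B \<noteq> B'"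
    then obtain p p' where p: "B = {i. 2 * i \<in> orbit \<pi> p}" "B' = {i. 2 * i \<in> orbit \<pi> p'}"
      unfolding psi_mem_iff by blast
    have False if "i \<in> B" "i \<in> B'" for i
    proof -
      have "2 * i \<in> orbit \<pi> p" "2 * i \<in> orbit \<pi> p'" using that p by simp_all
      then have "orbit \<pi> p = orbit \<pi> p'" using orbit_eq by metis
      then show False using p ne by simp
    qed
    then show "disjnt B B'" unfolding disjnt_iff by blast
  qed
next
  have "A = B" if A: "A \<in> psi n \<pi>" and B: "B \<in> psi n \<pi>"
    and lt: "a < b" "b < c" "c < d" and mem: "a \<in> A" "c \<in> A" "b \<in> B" "d \<in> B" for A B a b c d
  proof -
    obtain p where p: "odd p" "\<pi> p \<noteq> p" "A = {i. 2 * i \<in> orbit \<pi> p}"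
      using A unfolding psi_mem_iff by blast
    obtain q where q: "odd q" "\<pi> q \<noteq> q" "B = {i. 2 * i \<in> orbit \<pi> q}"
      using B unfolding psi_mem_iff by blast
    have o: "orbit \<pi> (2 * b) = orbit \<pi> q" "orbit \<pi> (2 * c) = orbit \<pi> p"
      using mem unfolding p(3) q(3) by (simp_all add: orbit_eq)
    have "2 * b \<in> {p..\<pi> p}"
      using orbit_bounds[OF p(1,2), of "2 * a"] orbit_bounds[OF p(1,2), of "2 * c"] mem p lt by auto
    then have "q \<in> {p..\<pi> p}" using orbit_in_interval[OF p(1,2)] self_in[of q] o(1) by blast
    then have "p \<le> q" by simp
    have "2 * c \<in> {q..\<pi> q}"
      using orbit_bounds[OF q(1,2), of "2 * b"] orbit_bounds[OF q(1,2), of "2 * d"] mem q lt by auto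
    then have "p \<in> {q..\<pi> q}" using orbit_in_interval[OF q(1,2)] self_in[of p] o(2) by blast
    with \<open>p \<le> q\<close> have "p = q" by simp
    then show ?thesis using p q by simp
  qed
  then show "noncrossing (psi n \<pi>)" unfolding noncrossing_def by meson
qed

end

section \<open>The permutation of a noncrossing partition\<close>

lemma noncrossingD:
  assumes "noncrossing P" "A \<in> P" "B \<in> P" "a < b" "b < c" "c < d" "a \<in> A" "c \<in> A" "b \<in> B" "d \<in> B"
  shows "A = B"
  using assms(1) unfolding noncrossing_def by (meson assms(2-))

text \<open>For disjoint blocks the union has at most one member, so it is the block of
  \<open>i\<close>, or \<open>{}\<close> if there is none.\<close>

definition block_of :: "'a set set \<Rightarrow> 'a \<Rightarrow> 'a set" where
  "block_of P i = \<Union> {B \<in> P. i \<in> B}"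

text \<open>Both \<open>2 i - 1\<close> and \<open>2 i\<close> have the index \<open>i = (x + 1) div 2\<close>.\<close>
definition perm_of :: "nat \<Rightarrow> nat set set \<Rightarrow> nat \<Rightarrow> nat" where
  "perm_of n P x =
     (if x \<notin> {1..2 * n} then x
      else let i = (x + 1) div 2; B = block_of P i in
        if even x then if i = Min B then x - 1 else 2 * Max {j \<in> B. j < i}
        else if i = Min B then 2 * Max B else x)"

section \<open>Evaluating \<open>perm_of\<close> on a partition\<close>

locale partition_interval =
  fixes n :: nat and P :: "nat set set"
  assumes part: "partition_on {1..n} P"
begin

lemma block_unique: "A \<in> P \<Longrightarrow> B \<in> P \<Longrightarrow> i \<in> A \<Longrightarrow> i \<in> B \<Longrightarrow> A = B"
  using partition_onD2[OF part] by (auto simp: disjoint_def)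

lemma block_of_eq: "B \<in> P \<Longrightarrow> i \<in> B \<Longrightarrow> block_of P i = B"
  unfolding block_of_def using block_unique by blast

lemma in_block: "i \<in> {1..n} \<Longrightarrow> \<exists>B. B \<in> P \<and> i \<in> B"
  using partition_onD1[OF part] by auto

lemma block_subset: "B \<in> P \<Longrightarrow> B \<subseteq> {1..n}"
  using partition_onD1[OF part] by auto

lemma finite_block: "B \<in> P \<Longrightarrow> finite B"
  using block_subset finite_subset by blast

lemma perm_of_outside: "x \<notin> {1..2 * n} \<Longrightarrow> perm_of n P x = x"
  by (simp only: perm_of_def if_True not_False_eq_True)

lemma perm_of_even_Min:
  assumes "B \<in> P" "i \<in> B" "i = Min B"
  shows "perm_of n P (2 * i) = 2 * i - 1"
  using block_subset[OF assms(1)] assms(2) block_of_eq[OF assms(1,2)] assms(3)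
  by (auto simp: perm_of_def Let_def)

lemma perm_of_odd:
  assumes "B \<in> P" "i \<in> B"
  shows "perm_of n P (2 * i - 1) = (if i = Min B then 2 * Max B else 2 * i - 1)"
proof -
  have i: "i \<in> {1..n}" using block_subset[OF assms(1)] assms(2) by blast
  then have "(2 * i - 1 + 1) div 2 = i" "odd (2 * i - 1)" "2 * i - 1 \<in> {1..2 * n}" by auto
  then have "perm_of n P (2 * i - 1) =
      (if i = Min (block_of P i) then 2 * Max (block_of P i) else 2 * i - 1)"
    unfolding perm_of_def Let_def by (simp only: not_True_eq_False if_False)
  then show ?thesis by (simp only: block_of_eq[OF assms])
qed

text \<open>Here \<open>j\<close> is the predecessor of \<open>i\<close> in its block; it exists
  because \<open>Min B\<close> lies below \<open>i\<close>.\<close>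

lemma perm_of_even:
  assumes "B \<in> P" "i \<in> B" "i \<noteq> Min B"
  obtains j where "perm_of n P (2 * i) = 2 * j" "j \<in> B" "j < i" "\<And>k. k \<in> B \<Longrightarrow> k < i \<Longrightarrow> k \<le> j"
proof -
  define S where "S = {j \<in> B. j < i}"
  have fin: "finite S" using finite_block[OF assms(1)] by (simp add: S_def)
  have "Min B \<in> B" "Min B \<le> i" using finite_block[OF assms(1)] assms(2) Min_in by auto
  then have "S \<noteq> {}" using assms(3) by (auto simp: S_def)
  then have "Max S \<in> S" using fin Max_in by blast
  moreover have "perm_of n P (2 * i) = 2 * Max S"
    using block_subset[OF assms(1)] assms(2,3) block_of_eq[OF assms(1,2)]
    by (auto simp: perm_of_def Let_def S_def)
  moreover have "k \<le> Max S" if "k \<in> B" "k < i" for k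
    using that fin by (auto simp: S_def)
  ultimately show ?thesis using that by (auto simp: S_def)
qed

text \<open>The case split for evaluating \<open>perm_of\<close>; \<open>i \<ge> 1\<close> excludes
  the truncated difference \<open>2 * 0 - 1\<close>.\<close>

lemma index_cases:
  assumes "x \<in> {1..2 * n}"
  obtains (even) i B where "x = 2 * i" "B \<in> P" "i \<in> B"
    | (odd) i B where "x = 2 * i - 1" "B \<in> P" "i \<in> B" "i \<ge> 1"
proof (cases "even x")
  case True
  then obtain i where "x = 2 * i" by (elim evenE)
  then show ?thesis using assms in_block[of i] even by auto
next
  case False
  then obtain j where "x = 2 * j + 1" by (elim oddE)
  then show ?thesis using assms in_block[of "Suc j"] odd[of "Suc j"] by auto
qed

end

text \<open>Applied in both directions this makes \<open>perm_of\<close> injective on partitions: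
  the values at even positions reveal the predecessor of every element in its block, and following
  predecessors recovers the block.\<close>

lemma perm_of_eq_imp_subset:
  assumes "partition_on {1..n} P" "partition_on {1..n} Q" "perm_of n P = perm_of n Q"
  shows "P \<subseteq> Q"
proof -
  interpret P: partition_interval n P by unfold_locales fact
  interpret Q: partition_interval n Q by unfold_locales fact
  \<comment> \<open>Stated for arbitrary \<open>P'\<close> and \<open>Q'\<close> so that the two
    partitions can be swapped; the induction steps from \<open>i\<close> to its predecessor
    \<open>k \<ge> j\<close>.\<close>
  have le: "\<exists>C\<in>Q'. i \<in> C \<and> j \<in> C"
    if "partition_on {1..n} P'" "partition_on {1..n} Q'" and eq: "perm_of n P' = perm_of n Q'"
      and B: "B \<in> P'" and "i \<in> B" "j \<in> B" "j \<le> i" for P' Q' B i j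
    using that(5-7)
  proof (induction i rule: less_induct)
    case (less i)
    interpret P': partition_interval n P' by unfold_locales fact
    interpret Q': partition_interval n Q' by unfold_locales fact
    have i: "i \<in> {1..n}" using P'.block_subset B less.prems by blast
    then obtain C where C: "C \<in> Q'" "i \<in> C" using Q'.in_block by blast
    show ?case
    proof (cases "j = i")
      case False
      then have ji: "j < i" using less.prems by simp
      have "i \<noteq> Min B"
        using ji less.prems Min_le[OF P'.finite_block[OF B] less.prems(2)] by linarith
      then obtain k where k: "perm_of n P' (2 * i) = 2 * k" "k \<in> B" "k < i" "j \<le> k"
        using P'.perm_of_even[OF B less.prems(1)] ji less.prems by metis
      have "i \<noteq> Min C"
      proof
        assume "i = Min C"
        then have "2 * k = 2 * i - 1" using Q'.perm_of_even_Min C k eq by simp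
        then show False using i by auto presburger
      qed
      then have "k \<in> C" using Q'.perm_of_even[OF C] k(1) eq
        by (metis mult_left_cancel zero_neq_numeral)
      moreover obtain C' where "C' \<in> Q'" "k \<in> C'" "j \<in> C'"
        using less.IH[of k] k less.prems by blast
      ultimately show ?thesis using Q'.block_unique C by blast
    qed (use C in blast)
  qed
  have same: "\<exists>C\<in>Q'. i \<in> C \<and> j \<in> C"
    if "partition_on {1..n} P'" "partition_on {1..n} Q'" "perm_of n P' = perm_of n Q'"
      "B \<in> P'" "i \<in> B" "j \<in> B" for P' Q' B i j
    using le[OF that(1-4), of i j] le[OF that(1-4), of j i] that(5,6) by (meson linear)
  show ?thesis
  proof
    fix B assume B: "B \<in> P"
    then obtain i where i: "i \<in> B" using partition_onD3[OF assms(1)] by fastforce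
    then obtain C where C: "C \<in> Q" "i \<in> C" using P.block_subset B Q.in_block by blast
    have "B \<subseteq> C" using same[OF assms B i] C Q.block_unique by blast
    moreover have "C \<subseteq> B"
      using same[OF assms(2,1) assms(3)[symmetric] C] i B P.block_unique by blast
    ultimately show "B \<in> Q" using C by auto
  qed
qed

section \<open>Recovering the permutation from its blocks, and counting fixed points\<close>

context dumont_3142
begin

text \<open>The orbit lies in \<open>{p..\<pi> p}\<close> with \<open>p\<close> odd, and both
  \<open>p + 1\<close> and \<open>\<pi> p\<close> are even entries of it, hence the extreme
  ones.\<close>

lemma psi_block_Min_Max:
  assumes "odd p" "\<pi> p \<noteq> p"
  shows "2 * Min {i. 2 * i \<in> orbit \<pi> p} = p + 1" "2 * Max {i. 2 * i \<in> orbit \<pi> p} = \<pi> p"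
proof -
  let ?B = "{i. 2 * i \<in> orbit \<pi> p}"
  have fin: "finite ?B"
    by (rule finite_subset[of _ "{..\<pi> p}"]) (use orbit_bounds[OF assms] in fastforce)+
  obtain m where m: "p + 1 = 2 * m" using assms(1) by (metis evenE even_plus_one_iff)
  obtain M where M: "\<pi> p = 2 * M" using excedance[OF assms] by (auto elim: evenE)
  have "Min ?B = m"
  proof (rule Min_eqI[OF fin])
    show "m \<le> y" if "y \<in> ?B" for y using orbit_bounds(1)[OF assms, of "2 * y"] that m by auto
  qed (use Suc_in_orbit[OF assms] m in simp)
  then show "2 * Min ?B = p + 1" using m by simp
  have "Max ?B = M"
  proof (rule Max_eqI[OF fin])
    show "y \<le> M" if "y \<in> ?B" for y using orbit_bounds(2)[OF assms, of "2 * y"] that M by auto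
  qed (use orbit.base[of \<pi> p] M in simp)
  then show "2 * Max ?B = \<pi> p" using M by simp
qed

lemma perm_of_psi: "perm_of n (psi n \<pi>) = \<pi>"
proof
  fix x
  interpret partition_interval n "psi n \<pi>"
    using psi_NC by unfold_locales (simp add: NC_def)
  show "perm_of n (psi n \<pi>) x = \<pi> x"
  proof (cases "x \<in> {1..2 * n}")
    case False
    then show ?thesis using outside perm_of_outside by simp
  next
    case True
    then show ?thesis
    proof (cases rule: index_cases)
      case (even i B)
      obtain p where p: "odd p" "\<pi> p \<noteq> p" "B = {i. 2 * i \<in> orbit \<pi> p}"
        using psi_mem_iff even by blast
      note mm = psi_block_Min_Max[OF p(1,2), folded p(3)]
      have x: "x \<in> orbit \<pi> p" using even p by auto
      show ?thesis
      proof (cases "i = Min B")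
        case True
        then have "perm_of n (psi n \<pi>) x = x - 1" using perm_of_even_Min even by blast
        moreover have "x = p + 1" using mm True even by simp
        ultimately show ?thesis using excedance[OF p(1,2)] by simp
      next
        case False
        then obtain j where j: "perm_of n (psi n \<pi>) (2 * i) = 2 * j" "j \<in> B" "j < i"
          "\<And>k. k \<in> B \<Longrightarrow> k < i \<Longrightarrow> k \<le> j" using perm_of_even even by metis
        \<comment> \<open>\<open>2 * j\<close> is an orbit entry below \<open>x\<close>, and no
          entry lies strictly between \<open>\<pi> x\<close> and \<open>x\<close>.\<close>
        have "2 * j \<le> \<pi> x"
          using orbit_step_least[OF p(1,2) x] even j p by force
        moreover have "\<pi> x \<le> 2 * j"
        proof -
          have px: "\<pi> x \<in> orbit \<pi> p" using x by (rule orbit.step)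
          \<comment> \<open>Only \<open>p + 1\<close>, the double of the block minimum, is sent to
            \<open>p\<close>. So \<open>\<pi> x\<close> is even, and its half is a block element
            below \<open>i\<close>, hence at most \<open>j\<close>.\<close>
          have "\<pi> x \<noteq> p"
          proof
            assume "\<pi> x = p"
            then have "x = p + 1" using inj excedance[OF p(1,2)] by metis
            then show False using False mm even by simp
          qed
          then have "even (\<pi> x)" using unique_odd p px by blast
          moreover have "\<pi> x < x" using even_less even True by simp
          ultimately show ?thesis using j(4)[of "\<pi> x div 2"] px p even by auto
        qed
        ultimately show ?thesis using j even by simp
      qed
    next
      case (odd i B)
      obtain p where p: "odd p" "\<pi> p \<noteq> p" "B = {i. 2 * i \<in> orbit \<pi> p}"
        using psi_mem_iff odd by blast
      note mm = psi_block_Min_Max[OF p(1,2), folded p(3)]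
      have "i = Min B \<longleftrightarrow> x = p" using mm odd by auto
      \<comment> \<open>A moved odd \<open>x\<close> would share the entry
        \<open>x + 1 = 2 * i\<close> with the orbit of \<open>p\<close>, giving that orbit two odd
        entries.\<close>
      moreover have "\<pi> x = x" if "x \<noteq> p"
      proof (rule ccontr)
        assume "\<pi> x \<noteq> x"
        moreover have ox: "odd x" using odd by simp
        ultimately have "x + 1 \<in> orbit \<pi> x" using Suc_in_orbit by blast
        then have "orbit \<pi> x = orbit \<pi> (2 * i)" using orbit_eq odd by simp
        also have "\<dots> = orbit \<pi> p" using orbit_eq odd p by auto
        finally show False using unique_odd[OF p(1,2) ox] self_in that by blast
      qed
      ultimately show ?thesis using perm_of_odd odd mm by auto
    qed
  qed
qed

text \<open>Blocks are disjoint, so their minima are distinct and count the parts; the remaining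
  indices count the fixed points. The additive form avoids truncated subtraction.\<close>

lemma card_psi: "card (psi n \<pi>) + card (fixed_points (2 * n) \<pi>) = n"
proof -
  interpret partition_interval n "psi n \<pi>"
    using psi_NC by unfold_locales (simp add: NC_def)
  let ?P = "psi n \<pi>"
  have Min_in_block: "Min B \<in> B" if "B \<in> ?P" for B
    using that finite_block partition_onD3[OF part] Min_in by metis
  have "inj_on Min ?P"
    by (rule inj_onI) (metis Min_in_block block_unique)
  then have c1: "card (Min ` ?P) = card ?P" by (rule card_image)
  have sub: "Min ` ?P \<subseteq> {1..n}" using Min_in_block block_subset by blast
  have "fixed_points (2 * n) \<pi> = (\<lambda>i. 2 * i - 1) ` ({1..n} - Min ` ?P)"
  proof (intro set_eqI iffI)
    fix x assume "x \<in> fixed_points (2 * n) \<pi>"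
    then have x: "x \<in> {1..2 * n}" "\<pi> x = x" by (auto simp: fixed_points_def)
    then have "odd x" using ge_imp_odd by simp
    from x(1) show "x \<in> (\<lambda>i. 2 * i - 1) ` ({1..n} - Min ` ?P)"
    proof (cases rule: index_cases)
      case (odd i B)
      have "i \<notin> Min ` ?P"
      proof
        assume "i \<in> Min ` ?P"
        then have "i = Min B" using odd Min_in_block block_unique by blast
        then have "x = 2 * Max B" using perm_of_odd[OF odd(2,3)] perm_of_psi x odd by simp
        then show False using \<open>odd x\<close> by simp
      qed
      then show ?thesis using odd block_subset by blast
    qed (use \<open>odd x\<close> in simp)
  next
    fix x assume "x \<in> (\<lambda>i. 2 * i - 1) ` ({1..n} - Min ` ?P)"
    then obtain i where i: "x = 2 * i - 1" "i \<in> {1..n}" "i \<notin> Min ` ?P" by blast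
    then obtain B where B: "B \<in> ?P" "i \<in> B" using in_block by blast
    then have "\<pi> x = x" using perm_of_odd[OF B] perm_of_psi i by auto
    then show "x \<in> fixed_points (2 * n) \<pi>" using i by (auto simp: fixed_points_def)
  qed
  moreover have "inj_on (\<lambda>i. 2 * i - 1) ({1..n} - Min ` ?P)"
    by (auto simp: inj_on_def)
  ultimately have "card (fixed_points (2 * n) \<pi>) = card ({1..n} - Min ` ?P)"
    using card_image by simp
  also have "\<dots> = n - card ?P" using c1 card_Diff_subset[OF finite_subset[OF sub] sub] by simp
  finally show ?thesis using card_mono[OF _ sub] c1 by simp
qed

end

text \<open>An injective self-map of the finite set \<open>{1..2 * n}\<close> is a permutation.
  Avoidance rests on two consequences of noncrossing: the invariant intervals in
  \<open>closed\<close> and the excluded configuration in \<open>no_crossing\<close>.\<close>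

lemma perm_of_dumont:
  assumes "P \<in> NC n"
  shows "perm_of n P \<in> dumont2_3142 n"
proof -
  interpret partition_interval n P
    using assms by unfold_locales (simp add: NC_def)
  have crossing: "A = B" if "A \<in> P" "B \<in> P" "a < b" "b < c" "c < d" "a \<in> A" "c \<in> A" "b \<in> B" "d \<in> B"
    for A B a b c d
    using assms noncrossingD that by (simp add: NC_def) metis
  let ?f = "perm_of n P"
  have Min_in_block: "Min B \<in> B" "Max B \<in> B" if "B \<in> P" for B
    using that finite_block partition_onD3[OF part] Min_in Max_in by metis+
  have Min_le_block: "Min B \<le> i" "i \<le> Max B" if "B \<in> P" "i \<in> B" for B i
    using that finite_block by auto
  have block_range: "1 \<le> i" "i \<le> n" if "B \<in> P" "i \<in> B" for B i
    using that block_subset by fastforce+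
  have even_lt: "?f (2 * i) < 2 * i" if "B \<in> P" "i \<in> B" for i B
  proof (cases "i = Min B")
    case True
    then show ?thesis using perm_of_even_Min[OF that] block_range[OF that] by simp
  next
    case False
    then obtain j where "?f (2 * i) = 2 * j" "j < i" by (rule perm_of_even[OF \<open>B \<in> P\<close> \<open>i \<in> B\<close>])
    then show ?thesis by simp
  qed
  have odd_ge: "2 * i - 1 \<le> ?f (2 * i - 1)" if "B \<in> P" "i \<in> B" for i B
    using perm_of_odd[OF that] Min_le_block[OF that] by auto
  have range: "?f x \<in> {1..2 * n}" if x: "x \<in> {1..2 * n}" for x
    using x
  proof (cases rule: index_cases)
    case (even i B)
    show ?thesis
    proof (cases "i = Min B")
      case True
      then show ?thesis using perm_of_even_Min[OF even(2,3)] even x by auto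
    next
      case False
      then obtain j where "?f (2 * i) = 2 * j" "j \<in> B" using perm_of_even even by metis
      then show ?thesis using even block_range[OF even(2)] by fastforce
    qed
  next
    case (odd i B)
    then show ?thesis
      using perm_of_odd[OF odd(2,3)] x block_range[OF odd(2) Min_in_block(2)[OF odd(2)]] by auto
  qed
  \<comment> \<open>Parity separates minima from other elements. Otherwise the common value
    \<open>2 * k\<close> puts both into the block of \<open>k\<close>, where each is the successor
    of \<open>k\<close>.\<close>
  have inj_even: "i = j"
    if "?f (2 * i) = ?f (2 * j)" and A: "A \<in> P" "i \<in> A" and B: "B \<in> P" "j \<in> B" for i j A B
  proof (cases "i = Min A")
    case True
    then have i: "?f (2 * i) = 2 * i - 1" using perm_of_even_Min A by blast
    show ?thesis
    proof (cases "j = Min B")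
      case True
      then have "?f (2 * j) = 2 * j - 1" using perm_of_even_Min B by blast
      then show ?thesis using i that(1) block_range[OF A] block_range[OF B] by simp
    next
      case False
      then obtain k where "?f (2 * j) = 2 * k" using perm_of_even B by metis
      then show ?thesis using i that(1) block_range[OF A] by presburger
    qed
  next
    case False
    then obtain k where k: "?f (2 * i) = 2 * k" "k \<in> A" "k < i" "\<And>m. m \<in> A \<Longrightarrow> m < i \<Longrightarrow> m \<le> k"
      using perm_of_even A by metis
    show ?thesis
    proof (cases "j = Min B")
      case True
      then have "?f (2 * j) = 2 * j - 1" using perm_of_even_Min B by blast
      then show ?thesis using k that(1) block_range[OF B] by presburger
    next
      case False
      then obtain m where m: "?f (2 * j) = 2 * m" "m \<in> B" "m < j" "\<And>l. l \<in> B \<Longrightarrow> l < j \<Longrightarrow> l \<le> m"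
        using perm_of_even B by metis
      then have "m = k" using k that(1) by simp
      then have "A = B" using block_unique A B m k by blast
      then show ?thesis using k m A B \<open>m = k\<close> by (metis leD linorder_neqE_nat)
    qed
  qed
  \<comment> \<open>An odd value \<open>2 * i - 1\<close> would need \<open>i\<close> to be both a
    minimum and not a minimum of its block; an even value would make a block maximum the predecessor
    of a larger element.\<close>
  have neq: "?f (2 * i) \<noteq> ?f (2 * j - 1)" if A: "A \<in> P" "i \<in> A" and B: "B \<in> P" "j \<in> B" for i j A B
  proof
    assume eq: "?f (2 * i) = ?f (2 * j - 1)"
    show False
    proof (cases "i = Min A")
      case True
      then have i: "?f (2 * i) = 2 * i - 1" using perm_of_even_Min A by blast
      show False
      proof (cases "j = Min B")
        case True
        then show False using perm_of_odd[OF B] i eq block_range[OF A] by simp presburger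
      next
        case False
        then have "i = j" using perm_of_odd[OF B] i eq block_range[OF A] block_range[OF B] by simp
        then show False using False True block_unique A B by blast
      qed
    next
      case False
      then obtain k where k: "?f (2 * i) = 2 * k" "k \<in> A" "k < i"
        using perm_of_even A by metis
      show False
      proof (cases "j = Min B")
        case True
        then have "k = Max B" using perm_of_odd[OF B] k eq by simp
        then have "A = B" using block_unique A B k Min_in_block by blast
        then show False using Min_le_block[OF A] k \<open>k = Max B\<close> by simp
      next
        case False
        then show False using perm_of_odd[OF B] k eq block_range[OF B] by simp presburger
      qed
    qed
  qed
  have inj_odd: "i = j"
    if "?f (2 * i - 1) = ?f (2 * j - 1)" and A: "A \<in> P" "i \<in> A" and B: "B \<in> P" "j \<in> B" for i j A B
  proof -
    have "Max A = Max B \<Longrightarrow> A = B" using Min_in_block A B block_unique by metis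
    moreover have "2 * i - 1 \<noteq> 2 * m" "2 * j - 1 \<noteq> 2 * m" for m
      using block_range[OF A] block_range[OF B] by presburger+
    ultimately show ?thesis
      using that(1) perm_of_odd[OF A] perm_of_odd[OF B] block_range[OF A] block_range[OF B]
      by (auto split: if_splits) metis+
  qed
  have inj: "inj_on ?f {1..2 * n}"
  proof (rule inj_onI)
    fix x y assume x: "x \<in> {1..2 * n}" and y: "y \<in> {1..2 * n}" and eq: "?f x = ?f y"
    from x show "x = y"
    proof (cases rule: index_cases)
      case X: (even i A)
      from y show ?thesis
        by (cases rule: index_cases) (use X eq inj_even neq in metis)+
    next
      case X: (odd i A)
      from y show ?thesis
        by (cases rule: index_cases) (use X eq inj_odd neq in metis)+
    qed
  qed
  have perm: "?f permutes {1..2 * n}"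
  proof (rule bij_imp_permutes)
    show "bij_betw ?f {1..2 * n} {1..2 * n}"
      unfolding bij_betw_def using inj range endo_inj_surj[of "{1..2 * n}" ?f] by blast
  qed (rule perm_of_outside)
  have closed: "?f ` {2 * Min B - 1..2 * Max B} = {2 * Min B - 1..2 * Max B}" (is "?f ` ?I = ?I")
    if B: "B \<in> P" for B
  proof -
    have mM: "1 \<le> Min B" "Max B \<le> n" using block_range B Min_in_block by blast+
    \<comment> \<open>If \<open>A\<close> reached beyond \<open>B\<close>, then
      \<open>Min A < Min B < i < Max B\<close> or \<open>Min B < i < Max B < Max A\<close> would be
      a crossing.\<close>
    have nested: "Min B \<le> Min A \<and> Max A \<le> Max B" if A: "A \<in> P" "i \<in> A" "Min B \<le> i" "i \<le> Max B" for A i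
    proof (cases "A = B")
      case False
      then have ne: "i \<noteq> Min B" "i \<noteq> Max B" using block_unique A B Min_in_block by blast+
      then have lt: "Min B < i" "i < Max B" using A by auto
      have "Min A \<noteq> Min B" "Max A \<noteq> Max B" using False block_unique A(1) B Min_in_block by metis+
      moreover have "\<not> Min A < Min B"
        using crossing[OF A(1) B _ lt] Min_in_block A B False by blast
      moreover have "\<not> Max B < Max A"
        using crossing[OF B A(1) lt] Min_in_block A B False by blast
      ultimately show ?thesis by linarith
    qed simp
    have "?f x \<in> ?I" if x: "x \<in> ?I" for x
    proof -
      have "x \<in> {1..2 * n}" using x mM by auto
      then show ?thesis
      proof (cases rule: index_cases)
        case (even i A)
        have n: "Min B \<le> Min A \<and> Max A \<le> Max B" using nested[OF even(2,3)] even x by auto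
        show ?thesis
        proof (cases "i = Min A")
          case True
          then show ?thesis using perm_of_even_Min[OF even(2,3)] even x n by auto
        next
          case False
          then obtain j where j: "?f (2 * i) = 2 * j" "j \<in> A" using perm_of_even even by metis
          then have "Min B \<le> j" "j \<le> Max B" using n Min_le_block[OF even(2)] by fastforce+
          then show ?thesis using j even by auto
        qed
      next
        case (odd i A)
        have n: "Min B \<le> Min A \<and> Max A \<le> Max B" using nested[OF odd(2,3)] odd x mM by auto
        show ?thesis
          using perm_of_odd[OF odd(2,3)] Min_le_block[OF odd(2,3)] odd x n by auto
      qed
    qed
    moreover have "?I \<subseteq> {1..2 * n}" using mM by auto
    ultimately show ?thesis
      by (intro endo_inj_surj inj_on_subset[OF inj]) auto
  qed
  have no_crossing: False if "?f b < ?f d" "?f d < b" "b < d" "1 \<le> b" "d \<le> 2 * n" for b d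
  proof -
    \<comment> \<open>The \<open>+ 1\<close> excludes the step from \<open>2 * Min A\<close> to
      \<open>2 * Min A - 1\<close>, leaving only steps to the block predecessor.\<close>
    have arc: "\<exists>i j A. x = 2 * i \<and> ?f x = 2 * j \<and> A \<in> P \<and> i \<in> A \<and> j \<in> A \<and> (\<forall>k\<in>A. k < i \<longrightarrow> k \<le> j)"
      if x: "x \<in> {1..2 * n}" "?f x + 1 < x" for x
      using x(1)
    proof (cases rule: index_cases)
      case (even i A)
      moreover have "i \<noteq> Min A" using perm_of_even_Min[OF even(2,3)] even x by auto
      ultimately show ?thesis using perm_of_even[of A i] by metis
    next
      case (odd i A)
      then show ?thesis using odd_ge[OF odd(2,3)] x by simp
    qed
    obtain i j A where b: "b = 2 * i" "?f b = 2 * j" "A \<in> P" "i \<in> A" "j \<in> A" "\<forall>k\<in>A. k < i \<longrightarrow> k \<le> j"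
      using arc[of b] \<open>?f b < ?f d\<close> \<open>?f d < b\<close> \<open>b < d\<close> \<open>1 \<le> b\<close> \<open>d \<le> 2 * n\<close> by auto
    obtain i' j' A' where d: "d = 2 * i'" "?f d = 2 * j'" "A' \<in> P" "i' \<in> A'" "j' \<in> A'"
      "\<forall>k\<in>A'. k < i' \<longrightarrow> k \<le> j'"
      using arc[of d] \<open>?f d < b\<close> \<open>b < d\<close> \<open>1 \<le> b\<close> \<open>d \<le> 2 * n\<close> by auto
    have lt: "j < j'" "j' < i" "i < i'" using that b(1,2) d(1,2) by auto
    \<comment> \<open>The arcs from \<open>j\<close> to \<open>i\<close> and from \<open>j'\<close>
      to \<open>i'\<close> cross, so they share a block; but then \<open>j'\<close> lies between
      \<open>i\<close> and its predecessor \<open>j\<close>.\<close>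
    then have "A = A'" using crossing b d by blast
    then show False using b d lt by fastforce
  qed
  have avoid: False
    if "1 \<le> a" "a < b" "b < c" "c < d" "d \<le> 2 * n" "?f b < ?f d" "?f d < ?f a" "?f a < ?f c" for a b c d
  proof (cases "?f d < b")
    case True
    then show False using no_crossing[of b d] that by simp
  next
    case False
    \<comment> \<open>Now \<open>a < b \<le> ?f d < ?f a\<close>, so \<open>a\<close> opens an
      invariant interval. The value at \<open>c\<close> is outside, which forces \<open>c\<close>
      and hence \<open>d\<close> beyond \<open>?f a\<close>, although the value at \<open>d\<close>
      is inside.\<close>
    then have af: "a < ?f a" using that by linarith
    have "a \<in> {1..2 * n}" using that by auto
    then obtain B where B: "B \<in> P" "a = 2 * Min B - 1" "?f a = 2 * Max B"
    proof (cases rule: index_cases)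
      case (even i B)
      then show ?thesis using even_lt[OF even(2,3)] af by simp
    next
      case (odd i B)
      then show ?thesis using perm_of_odd[OF odd(2,3)] af that by (auto split: if_splits)
    qed
    have cl: "?f ` {a..?f a} = {a..?f a}" using closed[OF B(1)] B(2,3) by simp
    have "?f c \<notin> {a..?f a}" using that(8) by simp
    then have "c \<notin> {a..?f a}" using cl by blast
    then have "?f a < d" using that by auto
    moreover have "?f d \<in> {a..?f a}" using False that by auto
    then obtain y where "y \<in> {a..?f a}" "?f y = ?f d" using cl by (metis imageE)
    then have "d \<in> {a..?f a}" using permutes_inj[OF perm] by (simp add: inj_eq)
    ultimately show False by simp
  qed
  have "?f (2 * i) < 2 * i \<and> 2 * i - 1 \<le> ?f (2 * i - 1)" if "i \<in> {1..n}" for i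
    using in_block[OF that] even_lt odd_ge by blast
  then show ?thesis
    unfolding dumont2_3142_def dumont2_def avoids_3142_iff using perm avoid by blast
qed

theorem mainTheorem6:
  fixes n :: nat
  assumes "n \<ge> 1"
  shows "bij_betw (psi n) (dumont2_3142 n) (NC n) \<and>
    (\<forall>k::nat. \<forall>\<pi>\<in>dumont2_3142 n.
       card (fixed_points (2 * n) \<pi>) = k \<longrightarrow> int (card (psi n \<pi>)) = int n - int k)"
proof (intro conjI allI ballI impI)
  show "bij_betw (psi n) (dumont2_3142 n) (NC n)"
  proof (rule bij_betw_byWitness[where f' = "perm_of n"])
    show "\<forall>\<pi>\<in>dumont2_3142 n. perm_of n (psi n \<pi>) = \<pi>"
      by (simp add: dumont_3142.intro dumont_3142.perm_of_psi)
    show "psi n ` dumont2_3142 n \<subseteq> NC n"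
      using dumont_3142.intro dumont_3142.psi_NC by blast
    show "perm_of n ` NC n \<subseteq> dumont2_3142 n"
      using perm_of_dumont by blast
    show "\<forall>P\<in>NC n. psi n (perm_of n P) = P"
    proof
      fix P assume P: "P \<in> NC n"
      then interpret dumont_3142 n "perm_of n P"
        by (intro dumont_3142.intro perm_of_dumont)
      have "partition_on {1..n} P" "partition_on {1..n} (psi n (perm_of n P))"
        using P psi_NC by (auto simp: NC_def)
      \<comment> \<open>\<open>perm_of_psi\<close> for the permutation \<open>perm_of n P\<close>
        shows that both partitions have the same image under \<open>perm_of\<close>, which is then
        cancelled by injectivity.\<close>
      then show "psi n (perm_of n P) = P"
        using perm_of_eq_imp_subset perm_of_psi by (metis subset_antisym)
    qed
  qed
next
  fix k \<pi> assume "\<pi> \<in> dumont2_3142 n" "card (fixed_points (2 * n) \<pi>) = k"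
  then have "card (psi n \<pi>) + k = n"
    using dumont_3142.intro dumont_3142.card_psi by blast
  then show "int (card (psi n \<pi>)) = int n - int k" by linarith
qed

end
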